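(* For every integer $d\ge 4$, the $3$-uniform cube hypergraph $Q^3_d$ is loose Hamilton connected: for any two distinct vertices $a,b$ of $Q^3_d$ there exists a loose path from $a$ to $b$ whose vertex set is the whole vertex set $\{0,1,2\}^d$.
   Context: For $d\in\mathbb{N}_0$, the cube hypergraph $Q^3_d$ is the $3$-uniform hypergraph with vertex set $V_d=\{0,1,2\}^d$ (sequences of length $d$ with entries in $\{0,1,2\}$), whose edges are all unordered triples $\{a,b,c\}$ of pairwise distinct sequences that agree in $d-1$ coordinates (so in the remaining coordinate they take the values $0,1,2$ in some order). A loose path of length $\ell$ from $v_0$ to $v_{2\ell}$ consists of distinct vertices $v_0,v_1,\dots,v_{2\ell}$ and distinct edges $e_1,\dots,e_\ell$ with $e_i=\{v_{2i-2},v_{2i-1},v_{2i}\}$ for $i=1,\dots,\ell$. A hypergraph is loose Hamilton connected if for any two distinct vertices $a,b$ there is a loose path from $a$ to $b$ containing all vertices. *)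

theory Defs
  imports Main
begin

definition cube_vertices :: "nat \<Rightarrow> nat list set" where
  "cube_vertices d = {v. length v = d \<and> (\<forall>k<d. v ! k < 3)}"

definition cube_edges :: "nat \<Rightarrow> nat list set set" where
  "cube_edges d = {{a, b, c} | a b c.
      a \<in> cube_vertices d \<and> b \<in> cube_vertices d \<and> c \<in> cube_vertices d \<and>
      a \<noteq> b \<and> b \<noteq> c \<and> a \<noteq> c \<and>
      (\<exists>i<d. \<forall>j<d. j \<noteq> i \<longrightarrow> a ! j = b ! j \<and> b ! j = c ! j)}"

definition loose_path :: "'a set set \<Rightarrow> 'a list \<Rightarrow> bool" where
  "loose_path E vs \<longleftrightarrow>
     odd (length vs) \<and> distinct vs \<and>
     (\<forall>i < length vs div 2. {vs ! (2*i), vs ! (2*i+1), vs ! (2*i+2)} \<in> E) \<and>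
     inj_on (\<lambda>i. {vs ! (2*i), vs ! (2*i+1), vs ! (2*i+2)}) {..< length vs div 2}"

definition loose_hamilton_connected :: "'a set \<Rightarrow> 'a set set \<Rightarrow> bool" where
  "loose_hamilton_connected V E \<longleftrightarrow>
     (\<forall>a\<in>V. \<forall>b\<in>V. a \<noteq> b \<longrightarrow>
        (\<exists>vs. loose_path E vs \<and> hd vs = a \<and> last vs = b \<and> set vs = V))"

end

theory Submission
  imports Defs
begin

text \<open>
  The induction is on a stronger property: for every line \<open>{r, m, n}\<close> and every vertex \<open>a\<close> off this
  line there is a loose path from \<open>r\<close> to \<open>a\<close> through all vertices except \<open>m\<close> and \<open>n\<close>. Adding the
  edge \<open>{n, m, r}\<close> in front yields Hamilton paths from \<open>n\<close>. Up to automorphisms there are six such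
  configurations in dimension 4 and eight in dimension 5, settled by explicit paths. The step goes
  from \<open>d\<close> to \<open>d + 2\<close>: fixing two coordinates, one of them the direction of the given line, splits
  the cube into nine blocks of dimension \<open>d\<close>. A parity count shows that passing between blocks
  must leave some blocks short of two vertices, and the strengthened property is what spans such
  a block when the two vertices are collinear with an end of the path in it.
\<close>

section \<open>Spanning loose paths\<close>

text \<open>The indexed form of \<open>loose_path\<close> is awkward to concatenate, reverse or map.
  Here each recursive step consumes one edge, that is, two vertices; only lists of odd length
  qualify, and distinctness is kept separate.\<close>

fun linked :: "'a set set \<Rightarrow> 'a list \<Rightarrow> bool" where
  "linked E [] \<longleftrightarrow> False"
| "linked E [v] \<longleftrightarrow> True"
| "linked E [v, w] \<longleftrightarrow> False"
| "linked E (u # v # w # vs) \<longleftrightarrow> {u, v, w} \<in> E \<and> linked E (w # vs)"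

text \<open>The vertex \<open>m\<close> becomes the middle of one extra edge between two odd lists,
  so the total length stays odd.\<close>

lemma linked_join:
  assumes "linked E xs" "{last xs, m, hd ys} \<in> E" "linked E ys"
  shows "linked E (xs @ m # ys)"
  using assms
proof (induction E xs rule: linked.induct)
  case (2 E v)
  then show ?case by (cases ys) auto
qed auto

lemma linked_rev: "linked E vs \<Longrightarrow> linked E (rev vs)"
proof (induction E vs rule: linked.induct)
  case (4 E u v w vs)
  have "linked E (rev (w # vs) @ v # [u])"
    by (rule linked_join) (use 4 in \<open>auto simp: insert_commute\<close>)
  then show ?case by simp
qed auto

lemma linked_map:
  "linked E vs \<Longrightarrow> (\<And>e. e \<in> E \<Longrightarrow> f ` e \<in> E') \<Longrightarrow> linked E' (map f vs)"
proof (induction E vs rule: linked.induct)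
  case (4 E u v w vs)
  then have "f ` {u, v, w} \<in> E'" by (metis linked.simps(4))
  with 4 show ?case by simp
qed auto

lemma linked_odd_length: "linked E vs \<Longrightarrow> odd (length vs)"
  by (induction E vs rule: linked.induct) auto

lemma linked_nth:
  "linked E vs \<Longrightarrow> i < length vs div 2 \<Longrightarrow> {vs ! (2*i), vs ! (2*i+1), vs ! (2*i+2)} \<in> E"
proof (induction E vs arbitrary: i rule: linked.induct)
  case (4 E u v w vs)
  then show ?case by (cases i) auto
qed auto

lemma linked_imp_loose_path:
  assumes "linked E vs" "distinct vs"
  shows "loose_path E vs"
proof -
  let ?e = "\<lambda>i. {vs ! (2*i), vs ! (2*i+1), vs ! (2*i+2)}"
  \<comment> \<open>Since the length is odd, even the last edge has a valid index
    \<open>2 * i + 2\<close>.\<close>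
  have bound: "2 * i + 2 < length vs" if "i < length vs div 2" for i
    using that linked_odd_length[OF assms(1)] by presburger
  have "inj_on ?e {..<length vs div 2}"
  proof (rule linorder_inj_onI)
    fix i j assume "i < j" "i \<in> {..<length vs div 2}" "j \<in> {..<length vs div 2}"
    \<comment> \<open>Edge \<open>j\<close> uses only indices from \<open>2 * j\<close> on, all
      larger than \<open>2 * i\<close>; distinctness thus keeps the first vertex of edge
      \<open>i\<close> out of it.\<close>
    then have "vs ! (2*i) \<notin> ?e j"
      using bound[of i] bound[of j] nth_eq_iff_index_eq[OF assms(2), of "2*i"] by auto
    then show "?e i \<noteq> ?e j" by blast
  qed auto
  then show ?thesis
    using assms linked_nth[OF assms(1)] linked_odd_length[OF assms(1)]
    unfolding loose_path_def by auto
qed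

text \<open>The visited set is a parameter so that parts of the cube, down to single vertices, can
  be spanned and then glued.\<close>

definition spanned :: "'a set set \<Rightarrow> 'a set \<Rightarrow> 'a \<Rightarrow> 'a \<Rightarrow> bool" where
  "spanned E S p q \<longleftrightarrow>
     (\<exists>vs. linked E vs \<and> distinct vs \<and> set vs = S \<and> hd vs = p \<and> last vs = q)"

lemma spanned_singleton: "spanned E {p} p p"
  unfolding spanned_def by (rule exI[of _ "[p]"]) simp

lemma spanned_sym: "spanned E S p q \<Longrightarrow> spanned E S q p"
  unfolding spanned_def by (metis linked_rev distinct_rev set_rev hd_rev last_rev)

lemma spanned_join:
  assumes "spanned E S p q" "spanned E T p' q'" "{q, m, p'} \<in> E"
    and "m \<notin> S" "m \<notin> T" "S \<inter> T = {}"
  shows "spanned E (insert m (S \<union> T)) p q'"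
proof -
  obtain xs where xs: "linked E xs" "distinct xs" "set xs = S" "hd xs = p" "last xs = q"
    using assms(1) unfolding spanned_def by auto
  obtain ys where ys: "linked E ys" "distinct ys" "set ys = T" "hd ys = p'" "last ys = q'"
    using assms(2) unfolding spanned_def by auto
  have "xs \<noteq> []" "ys \<noteq> []" using xs ys by auto
  moreover have "linked E (xs @ m # ys)" using xs ys assms(3) by (intro linked_join) auto
  ultimately show ?thesis
    unfolding spanned_def using xs ys assms by (intro exI[of _ "xs @ m # ys"]) auto
qed

lemma spanned_image:
  assumes "spanned E S p q" "inj_on f S" "\<And>e. e \<in> E \<Longrightarrow> f ` e \<in> E'"
  shows "spanned E' (f ` S) (f p) (f q)"
proof -
  obtain xs where xs: "linked E xs" "distinct xs" "set xs = S" "hd xs = p" "last xs = q"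
    using assms(1) unfolding spanned_def by auto
  have "xs \<noteq> []" using xs by auto
  then show ?thesis
    unfolding spanned_def using xs assms linked_map[OF xs(1), of f E']
    by (intro exI[of _ "map f xs"]) (auto simp: distinct_map hd_map last_map)
qed

text \<open>An injection of the vertices acts injectively on the finite edge set, hence permutes it.
  Its inverse therefore preserves edges as well and carries the path back.\<close>

lemma spanned_image_cancel:
  assumes "spanned E (f ` S) (f p) (f q)"
    and inj: "inj_on f V" and fin: "finite V" and V: "f ` V \<subseteq> V"
    and E: "\<And>e. e \<in> E \<Longrightarrow> e \<subseteq> V" "\<And>e. e \<in> E \<Longrightarrow> f ` e \<in> E"
    and "S \<subseteq> V" "p \<in> V" "q \<in> V"
  shows "spanned E S p q"
proof -
  let ?g = "inv_into V f"
  have "finite E" using fin E(1) by (meson Pow_iff finite_Pow_iff finite_subset subsetI)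
  moreover have "inj_on ((`) f) E" using inj E(1) by (meson inj_on_image_Pow inj_on_subset Pow_iff subsetI)
  ultimately have surj: "(`) f ` E = E" using E(2) by (intro endo_inj_surj) auto
  have g: "?g ` f ` T = T" if "T \<subseteq> V" for T
    using inj that by (rule inv_into_image_cancel)
  have "?g ` e \<in> E" if "e \<in> E" for e
  proof -
    have "e \<in> (`) f ` E" by (simp only: surj that)
    then obtain e' where "e' \<in> E" "e = f ` e'" by (rule imageE)
    then show ?thesis by (simp add: g E(1))
  qed
  moreover have "inj_on ?g (f ` S)" using \<open>S \<subseteq> V\<close> by (intro inj_on_inv_into) auto
  ultimately have "spanned E (?g ` f ` S) (?g (f p)) (?g (f q))"
    by (intro spanned_image[OF assms(1)]) auto
  then show ?thesis using g assms by simp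
qed

section \<open>Edges and automorphisms of the cube\<close>

lemma length_cube_vertex: "v \<in> cube_vertices d \<Longrightarrow> length v = d"
  by (simp add: cube_vertices_def)

lemma nth_cube_vertex: "v \<in> cube_vertices d \<Longrightarrow> k < d \<Longrightarrow> v ! k < 3"
  by (simp add: cube_vertices_def)

lemma Cons_in_cube_vertices [simp]:
  "h # v \<in> cube_vertices (Suc d) \<longleftrightarrow> h < 3 \<and> v \<in> cube_vertices d"
  by (auto simp: cube_vertices_def nth_Cons split: nat.splits)

lemma cube_vertices_0 [simp]: "cube_vertices 0 = {[]}"
  by (auto simp: cube_vertices_def)

lemma cube_vertices_Suc: "cube_vertices (Suc d) = (\<Union>h<3. (#) h ` cube_vertices d)"
proof -
  have "v \<in> (\<Union>h<3. (#) h ` cube_vertices d)" if "v \<in> cube_vertices (Suc d)" for v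
    using that length_cube_vertex[OF that] by (cases v) auto
  then show ?thesis by auto
qed

lemma cube_vertices_eq_lists: "cube_vertices d = {v. set v \<subseteq> {..<3} \<and> length v = d}"
  by (auto simp: cube_vertices_def set_conv_nth)

lemma finite_cube_vertices: "finite (cube_vertices d)"
  by (simp add: cube_vertices_eq_lists finite_lists_length_eq)

lemma card_cube_vertices: "card (cube_vertices d) = 3 ^ d"
  by (simp add: cube_vertices_eq_lists card_lists_length_eq)

lemma list_update_in_cube_vertices: "v \<in> cube_vertices d \<Longrightarrow> h < 3 \<Longrightarrow> v[i := h] \<in> cube_vertices d"
  by (cases "i < d") (auto simp: cube_vertices_def nth_list_update)

lemma replicate_in_cube_vertices [simp]: "replicate d 0 \<in> cube_vertices d"
  by (simp add: cube_vertices_def)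

lemma cube_edgeI:
  assumes "v \<in> cube_vertices d" "i < d"
  shows "(\<lambda>h. v[i := h]) ` {..<3} \<in> cube_edges d"
proof -
  have *: "{..<3} = {0, 1, 2 :: nat}" by auto
  have "v[i := g] \<noteq> v[i := h]" if "g \<noteq> h" for g h
    using that assms length_cube_vertex[OF assms(1)] by (metis nth_list_update_eq)
  then show ?thesis
    unfolding cube_edges_def mem_Collect_eq *
    using assms list_update_in_cube_vertices[OF assms(1)]
    by (intro exI[of _ "v[i := 0]"] exI[of _ "v[i := 1]"] exI[of _ "v[i := 2]"])
      (auto intro!: exI[of _ i])
qed

text \<open>The condition \<open>{x, y, z} = {..<3}\<close> allows any order of the three values, so
  any vertex of a line may serve as the middle one.\<close>

lemma cube_edge_triple:
  assumes "v \<in> cube_vertices d" "i < d" "{x, y, z} = {..<3}"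
  shows "{v[i := x], v[i := y], v[i := z]} \<in> cube_edges d"
  using cube_edgeI[OF assms(1,2)] unfolding assms(3)[symmetric] by simp

text \<open>In the coordinate where they may vary, three distinct vertices have distinct entries
  below 3, hence all of 0, 1, 2. So every edge is a full coordinate line.\<close>

lemma cube_edgeE:
  assumes "e \<in> cube_edges d"
  obtains v i where "v \<in> cube_vertices d" "i < d" "e = (\<lambda>h. v[i := h]) ` {..<3}"
proof -
  obtain a b c i where abc: "e = {a, b, c}" "a \<in> cube_vertices d" "b \<in> cube_vertices d"
      "c \<in> cube_vertices d" "a \<noteq> b" "b \<noteq> c" "a \<noteq> c" "i < d"
      and eq: "\<forall>j<d. j \<noteq> i \<longrightarrow> a ! j = b ! j \<and> b ! j = c ! j"
    using assms unfolding cube_edges_def by blast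
  have upd: "a[i := a ! i] = a" "a[i := b ! i] = b" "a[i := c ! i] = c"
    using abc eq by (auto intro!: nth_equalityI simp: length_cube_vertex nth_list_update)
  then have "a ! i \<noteq> b ! i" "b ! i \<noteq> c ! i" "a ! i \<noteq> c ! i"
    using abc(5-7) by metis+
  moreover have "a ! i < 3" "b ! i < 3" "c ! i < 3" using abc by (auto simp: nth_cube_vertex)
  ultimately have "{..<3} = {a ! i, b ! i, c ! i}" by auto
  then have "e = (\<lambda>h. a[i := h]) ` {..<3}" using upd abc(1) by simp
  then show ?thesis using that abc by blast
qed

lemma cube_edge_subset: "e \<in> cube_edges d \<Longrightarrow> e \<subseteq> cube_vertices d"
  by (auto simp: cube_edges_def)

lemma Cons_image_cube_edge:
  assumes "e \<in> cube_edges d" "g < 3"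
  shows "(#) g ` e \<in> cube_edges (Suc d)"
proof -
  obtain v i where "v \<in> cube_vertices d" "i < d" "e = (\<lambda>h. v[i := h]) ` {..<3}"
    using assms(1) by (rule cube_edgeE)
  then show ?thesis using cube_edgeI[of "g # v" "Suc d" "Suc i"] assms(2) by (simp add: image_image)
qed

lemma Cons_cube_edge:
  assumes "v \<in> cube_vertices d" "{x, y, z} = {..<3}"
  shows "{x # v, y # v, z # v} \<in> cube_edges (Suc d)"
  using cube_edge_triple[of "0 # v" "Suc d" 0 x y z] assms by simp

text \<open>When \<open>js\<close> lists every coordinate once and each \<open>\<sigma> j\<close>
  permutes 0, 1, 2, these maps form the wreath product of S_3 with the symmetric group on the
  coordinates. The index of \<open>\<sigma>\<close> is the old coordinate.\<close>

definition cube_aut :: "nat list \<Rightarrow> (nat \<Rightarrow> nat \<Rightarrow> nat) \<Rightarrow> nat list \<Rightarrow> nat list" where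
  "cube_aut js \<sigma> v = map (\<lambda>j. \<sigma> j (v ! j)) js"

context
  fixes d :: nat and js :: "nat list" and \<sigma> :: "nat \<Rightarrow> nat \<Rightarrow> nat"
  assumes js: "distinct js" "set js = {..<d}"
    and \<sigma>: "\<And>j. j < d \<Longrightarrow> bij_betw (\<sigma> j) {..<3} {..<3}"
begin

lemma cube_aut_in_cube_vertices:
  assumes "v \<in> cube_vertices d" shows "cube_aut js \<sigma> v \<in> cube_vertices d"
proof -
  have "length js = d" using js distinct_card[of js] by simp
  moreover have "\<sigma> j (v ! j) < 3" if "j < d" for j
    using bij_betwE[OF \<sigma>[OF that]] nth_cube_vertex[OF assms that] by auto
  ultimately show ?thesis using js
    by (auto simp: cube_vertices_eq_lists cube_aut_def)
qed

lemma inj_on_cube_aut: "inj_on (cube_aut js \<sigma>) (cube_vertices d)"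
proof (rule inj_onI)
  fix v w assume v: "v \<in> cube_vertices d" and w: "w \<in> cube_vertices d"
    and eq: "cube_aut js \<sigma> v = cube_aut js \<sigma> w"
  have "v ! j = w ! j" if "j < d" for j
  proof -
    have "\<sigma> j (v ! j) = \<sigma> j (w ! j)" using eq that js by (auto simp: cube_aut_def)
    then show ?thesis
      using bij_betw_imp_inj_on[OF \<sigma>[OF that]] nth_cube_vertex[OF v that] nth_cube_vertex[OF w that]
      by (auto dest: inj_onD)
  qed
  then show "v = w" using v w by (auto intro!: nth_equalityI simp: length_cube_vertex)
qed

text \<open>A line in direction \<open>i\<close> goes to a line in direction \<open>l\<close>, the
  position of \<open>i\<close> in \<open>js\<close>; \<open>\<sigma> i\<close> merely permutes the
  values along it.\<close>

lemma cube_aut_image_edge: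
  assumes "e \<in> cube_edges d"
  shows "cube_aut js \<sigma> ` e \<in> cube_edges d"
proof -
  obtain v i where vi: "v \<in> cube_vertices d" "i < d" "e = (\<lambda>h. v[i := h]) ` {..<3}"
    using assms by (rule cube_edgeE)
  have len: "length js = d" using js distinct_card[of js] by simp
  obtain l where l: "l < d" "js ! l = i" using js vi(2) len by (metis in_set_conv_nth lessThan_iff)
  have "cube_aut js \<sigma> (v[i := h]) = (cube_aut js \<sigma> v)[l := \<sigma> i h]" for h
  proof (rule nth_equalityI)
    fix k assume "k < length (cube_aut js \<sigma> (v[i := h]))"
    then have k: "k < d" by (simp add: cube_aut_def len)
    have "js ! k = i \<longleftrightarrow> k = l"
      using nth_eq_iff_index_eq[OF js(1), of k l] k l len by auto
    then show "cube_aut js \<sigma> (v[i := h]) ! k = (cube_aut js \<sigma> v)[l := \<sigma> i h] ! k"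
      using k len vi(2) length_cube_vertex[OF vi(1)]
      by (cases "k = l") (simp_all add: cube_aut_def)
  qed (simp add: cube_aut_def)
  then have "cube_aut js \<sigma> ` e = (\<lambda>h. (cube_aut js \<sigma> v)[l := h]) ` \<sigma> i ` {..<3}"
    unfolding vi(3) image_image by simp
  then show ?thesis
    using cube_edgeI[OF cube_aut_in_cube_vertices[OF vi(1)] l(1)] \<sigma>[OF vi(2)]
    by (simp add: bij_betw_def)
qed

lemma spanned_cube_aut_cancel:
  assumes "spanned (cube_edges d) (cube_aut js \<sigma> ` S) (cube_aut js \<sigma> p) (cube_aut js \<sigma> q)"
    and "S \<subseteq> cube_vertices d" "p \<in> cube_vertices d" "q \<in> cube_vertices d"
  shows "spanned (cube_edges d) S p q"
  using assms(1) inj_on_cube_aut finite_cube_vertices _ cube_edge_subset cube_aut_image_edge assms(2-4)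
  by (rule spanned_image_cancel) (use cube_aut_in_cube_vertices in auto)

end

section \<open>Reduction to a normal form\<close>

text \<open>Removing two vertices leaves an odd number, as a loose path requires.\<close>

definition tip_connected :: "nat \<Rightarrow> bool" where
  "tip_connected d \<longleftrightarrow>
     (\<forall>r m n a. {r, m, n} \<in> cube_edges d \<longrightarrow> a \<in> cube_vertices d - {r, m, n} \<longrightarrow>
        spanned (cube_edges d) (cube_vertices d - {m, n}) r a)"

lemma cube_edge_distinct:
  assumes "{x, y, z} \<in> cube_edges d"
  shows "x \<noteq> y" "y \<noteq> z" "x \<noteq> z"
proof -
  have "card {x, y, z} = 3" using assms by (auto simp: cube_edges_def)
  then show "x \<noteq> y" "y \<noteq> z" "x \<noteq> z"
    by (auto simp: card_insert_if split: if_splits)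
qed

text \<open>Used for one coordinate at a time, with \<open>x\<close> the entry of the start and
  \<open>y\<close> that of the target. If they agree, some other value \<open>y'\<close> is sent to
  1 to complete the permutation.\<close>

lemma exists_relabelling:
  fixes x y :: nat
  assumes "x < 3" "y < 3"
  shows "\<exists>\<pi>. bij_betw \<pi> {..<3} {..<3 :: nat} \<and> \<pi> x = 0 \<and> (x \<noteq> y \<longrightarrow> \<pi> y = 1)"
proof -
  obtain y' where y': "y' < 3" "y' \<noteq> x" "x \<noteq> y \<longrightarrow> y' = y"
  proof (cases "x = y")
    case True
    then show ?thesis using that[of "if x = 0 then 1 else 0"] by auto
  qed (use assms that in auto)
  let ?\<pi> = "\<lambda>z. if z = x then 0 else if z = y' then 1 else 2 :: nat"
  have "inj_on ?\<pi> {..<3}" using assms y' by (auto simp: inj_on_def)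
  moreover have "?\<pi> ` {..<3} \<subseteq> {..<3}" by auto
  ultimately have "bij_betw ?\<pi> {..<3} {..<3}"
    using endo_inj_surj[of "{..<3}" ?\<pi>] unfolding bij_betw_def by blast
  then show ?thesis using y' by (intro exI[of _ ?\<pi>]) auto
qed

text \<open>An automorphism moves \<open>r\<close> to the zero vector and the direction of the line
  to the front, and turns the entries of \<open>a\<close> that differ from those of \<open>r\<close>
  into 1. After sorting the other coordinates, only the number \<open>k\<close> of differences off
  the line direction and the entry \<open>c\<close> along it remain.\<close>

lemma tip_connected_SucI:
  assumes "\<And>k c. 0 < k \<Longrightarrow> k \<le> d \<Longrightarrow> c < 2 \<Longrightarrow>
    spanned (cube_edges (Suc d))
      (cube_vertices (Suc d) - {1 # replicate d 0, 2 # replicate d 0})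
      (replicate (Suc d) 0) (c # replicate k 1 @ replicate (d - k) 0)"
  shows "tip_connected (Suc d)"
  unfolding tip_connected_def
proof (intro allI impI)
  let ?V = "cube_vertices (Suc d)" and ?E = "cube_edges (Suc d)"
  fix r m n a assume e: "{r, m, n} \<in> ?E" and a: "a \<in> ?V - {r, m, n}"
  note dist = cube_edge_distinct[OF e]
  have V: "r \<in> ?V" "a \<in> ?V" using cube_edge_subset[OF e] a by auto
  obtain v i where i: "i < Suc d" and v: "v \<in> ?V" "{r, m, n} = (\<lambda>h. v[i := h]) ` {..<3}"
    using e by (rule cube_edgeE)
  then obtain h0 where "r = v[i := h0]" by blast
  then have line: "{r, m, n} = (\<lambda>h. r[i := h]) ` {..<3}" using v(2) by simp

  have "\<forall>j. \<exists>\<pi>. j < Suc d \<longrightarrow> bij_betw \<pi> {..<3} {..<3 :: nat} \<and> \<pi> (r ! j) = 0 \<and>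
      (r ! j \<noteq> a ! j \<longrightarrow> \<pi> (a ! j) = 1)"
    using exists_relabelling nth_cube_vertex[OF V(1)] nth_cube_vertex[OF V(2)] by metis
  then obtain \<sigma> where \<sigma>: "\<And>j. j < Suc d \<Longrightarrow> bij_betw (\<sigma> j) {..<3} {..<3 :: nat}"
      "\<And>j. j < Suc d \<Longrightarrow> \<sigma> j (r ! j) = 0"
      "\<And>j. j < Suc d \<Longrightarrow> r ! j \<noteq> a ! j \<Longrightarrow> \<sigma> j (a ! j) = 1"
    by metis
  \<comment> \<open>The new order of coordinates is the line direction, then the other ones where
    \<open>r\<close> and \<open>a\<close> differ, then those where they agree.\<close>
  define B where "B = filter (\<lambda>j. j \<noteq> i \<and> r ! j \<noteq> a ! j) [0..<Suc d]"
  define C where "C = filter (\<lambda>j. j \<noteq> i \<and> r ! j = a ! j) [0..<Suc d]"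
  define js where "js = i # B @ C"
  have js: "distinct js" "set js = {..<Suc d}"
    using i by (auto simp: js_def B_def C_def)
  have B: "j < Suc d \<and> j \<noteq> i \<and> r ! j \<noteq> a ! j" if "j \<in> set B" for j
    using that by (auto simp: B_def simp del: upt_Suc)
  have C: "j < Suc d \<and> j \<noteq> i \<and> r ! j = a ! j" if "j \<in> set C" for j
    using that by (auto simp: C_def simp del: upt_Suc)
  have len: "length B + length C = d"
    using distinct_card[OF js(1)] js(2) by (simp add: js_def)
  \<comment> \<open>Otherwise \<open>a\<close> would lie on the given line. This yields
    \<open>0 < k\<close>.\<close>
  have "B \<noteq> []"
  proof
    assume "B = []"
    then have "r ! j = a ! j" if "j < Suc d" "j \<noteq> i" for j
      using that by (auto simp: B_def filter_empty_conv simp del: upt_Suc)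
    then have "a = r[i := a ! i]"
      using V i by (intro nth_equalityI) (auto simp: length_cube_vertex nth_list_update)
    moreover have "a ! i < 3" using V i by (simp add: nth_cube_vertex)
    ultimately have "a \<in> {r, m, n}" unfolding line by blast
    then show False using a by simp
  qed
  let ?f = "cube_aut js \<sigma>"
  have f_line: "?f (r[i := h]) = \<sigma> i h # replicate d 0" for h
  proof -
    have "\<sigma> j (r[i := h] ! j) = 0" if "j \<in> set (B @ C)" for j
      using that \<sigma>(2)[of j] B[of j] C[of j] by (metis Un_iff nth_list_update_neq set_append)
    then have "map (\<lambda>j. \<sigma> j (r[i := h] ! j)) (B @ C) = map (\<lambda>j. 0) (B @ C)"
      by (intro map_cong) auto
    then show ?thesis
      using len i length_cube_vertex[OF V(1)]
      by (simp add: cube_aut_def js_def map_replicate_const replicate_add[symmetric])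
  qed
  then have fr: "?f r = replicate (Suc d) 0" using \<sigma>(2)[OF i] by (metis list_update_id replicate_Suc)
  have fe: "?f ` {r, m, n} = (\<lambda>h. h # replicate d 0) ` {..<3}"
  proof -
    have "?f ` {r, m, n} = (\<lambda>h. h # replicate d 0) ` \<sigma> i ` {..<3}"
      unfolding line image_image by (simp add: f_line)
    then show ?thesis using \<sigma>(1)[OF i] by (simp add: bij_betw_def)
  qed
  have fa: "?f a = \<sigma> i (a ! i) # replicate (length B) 1 @ replicate (d - length B) 0"
  proof -
    have "map (\<lambda>j. \<sigma> j (a ! j)) B = map (\<lambda>j. 1) B"
      using \<sigma>(3) B by (intro map_cong) auto
    moreover have "map (\<lambda>j. \<sigma> j (a ! j)) C = map (\<lambda>j. 0) C"
      using \<sigma>(2) C by (intro map_cong) metis+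
    moreover have "length C = d - length B" using len by simp
    ultimately show ?thesis by (simp add: cube_aut_def js_def map_replicate_const)
  qed
  have "\<sigma> i (a ! i) < 2" using \<sigma>(2,3)[OF i] by (cases "r ! i = a ! i") auto
  have inj: "inj_on ?f ?V" using js \<sigma>(1) by (rule inj_on_cube_aut)
  have "?f v \<in> ?V" if "v \<in> ?V" for v using js \<sigma>(1) that by (rule cube_aut_in_cube_vertices)
  then have fV: "?f ` ?V = ?V" by (intro endo_inj_surj inj finite_cube_vertices) auto
  have "?f ` (?V - {m, n}) = ?V - ?f ` {m, n}"
    using inj_on_image_set_diff[OF inj, of ?V "{m, n}"] cube_edge_subset[OF e] fV by auto
  \<comment> \<open>Which of \<open>m\<close> and \<open>n\<close> receives the entry 1 is not
    determined, so only the image of the pair is computed, as the image of the line without that of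
    \<open>r\<close>.\<close>
  also have "?f ` {m, n} = ?f ` ({r, m, n} - {r})" using dist by auto
  also have "\<dots> = ?f ` {r, m, n} - ?f ` {r}"
    using inj_on_image_set_diff[OF inj, of "{r, m, n}" "{r}"] cube_edge_subset[OF e] by auto
  also have "\<dots> = {1 # replicate d 0, 2 # replicate d 0}"
  proof -
    have "{..<3} = {0, 1, 2 :: nat}" by auto
    then show ?thesis unfolding fe by (simp add: fr)
  qed
  finally have fS: "?f ` (?V - {m, n}) = ?V - {1 # replicate d 0, 2 # replicate d 0}" .
  have "spanned ?E (?f ` (?V - {m, n})) (?f r) (?f a)"
    unfolding fS fr fa using assms[of "length B" "\<sigma> i (a ! i)"] \<open>B \<noteq> []\<close> len \<open>\<sigma> i (a ! i) < 2\<close>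
    by auto
  from js \<sigma>(1) this show "spanned ?E (?V - {m, n}) r a"
    by (rule spanned_cube_aut_cancel) (use V in auto)
qed

section \<open>Explicit paths in dimensions four and five\<close>

text \<open>The move \<open>(i, s)\<close> traverses the line in direction \<open>i\<close> through the current vertex, adding \<open>s\<close>
  modulo 3 to coordinate \<open>i\<close> twice. For \<open>s \<in> {1, 2}\<close> this gives an edge.\<close>

fun walk :: "nat list \<Rightarrow> (nat \<times> nat) list \<Rightarrow> nat list list" where
  "walk v [] = [v]"
| "walk v ((i, s) # ms) = v # v[i := (v ! i + s) mod 3] # walk (v[i := (v ! i + 2 * s) mod 3]) ms"

lemma hd_walk: "hd (walk v ms) = v"
  by (induction v ms rule: walk.induct) auto

lemma length_walk: "length (walk v ms) = Suc (2 * length ms)"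
  by (induction v ms rule: walk.induct) auto

lemma linked_walk:
  assumes "v \<in> cube_vertices d" "\<forall>(i, s) \<in> set ms. i < d \<and> s \<in> {1, 2}"
  shows "linked (cube_edges d) (walk v ms)"
  using assms
proof (induction v ms rule: walk.induct)
  case (2 v i s ms)
  let ?w = "v[i := (v ! i + 2 * s) mod 3]"
  have i: "i < d" and s: "s = 1 \<or> s = 2" using 2 by auto
  have "v ! i = 0 \<or> v ! i = 1 \<or> v ! i = 2" using nth_cube_vertex[OF 2(2) i] by linarith
  \<comment> \<open>Both 1 and 2 are invertible modulo 3, so the multiples of \<open>s\<close> run
    through all residues.\<close>
  then have "{v ! i, (v ! i + s) mod 3, (v ! i + 2 * s) mod 3} = {..<3}" using s by auto
  then have "{v[i := v ! i], v[i := (v ! i + s) mod 3], ?w} \<in> cube_edges d"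
    by (intro cube_edge_triple 2 i)
  moreover have "linked (cube_edges d) (walk ?w ms)"
    using 2 by (intro 2(1)) (auto intro: list_update_in_cube_vertices)
  ultimately show ?case
    using hd_walk[of ?w ms] length_walk[of ?w ms] by (cases "walk ?w ms") auto
qed auto

section \<open>Checking explicit walks by evaluation\<close>

fun tails :: "nat \<Rightarrow> nat list list \<Rightarrow> nat list list" where
  "tails h [] = []"
| "tails h ([] # vs) = tails h vs"
| "tails h ((x # v) # vs) = (if x = h then v # tails h vs else tails h vs)"

text \<open>Coverage is tested by sorting on one entry after the other, without forming the set of
  all vertices.\<close>

fun covers :: "nat \<Rightarrow> nat list list \<Rightarrow> bool" where
  "covers 0 vs \<longleftrightarrow> [] \<in> set vs"
| "covers (Suc d) vs \<longleftrightarrow> covers d (tails 0 vs) \<and> covers d (tails 1 vs) \<and> covers d (tails 2 vs)"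

lemma set_tails: "v \<in> set (tails h vs) \<longleftrightarrow> h # v \<in> set vs"
  by (induction h vs rule: tails.induct) auto

lemma covers_imp_subset: "covers d vs \<Longrightarrow> cube_vertices d \<subseteq> set vs"
proof (induction d vs rule: covers.induct)
  case (2 d vs)
  have "h # v \<in> set vs" if "h < 3" "v \<in> cube_vertices d" for h v
  proof -
    have "h = 0 \<or> h = 1 \<or> h = 2" using that(1) by linarith
    then have "v \<in> set (tails h vs)" using 2 that(2) by auto
    then show ?thesis by (simp add: set_tails)
  qed
  then show ?case by (auto simp: cube_vertices_Suc)
qed simp

text \<open>The dimension is \<open>Suc d\<close>. The two omitted vertices are put in front of the
  walk, so that the combined list has to cover the whole cube; the length condition counts them
  too.\<close>

definition certificate :: "nat \<Rightarrow> nat \<Rightarrow> nat \<Rightarrow> (nat \<times> nat) list \<Rightarrow> bool" where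
  "certificate d k c ms \<longleftrightarrow>
     (\<forall>(i, s) \<in> set ms. i < Suc d \<and> s \<in> set [1, 2]) \<and>
     2 * length ms + 3 = 3 ^ Suc d \<and>
     last (walk (replicate (Suc d) 0) ms) = c # replicate k 1 @ replicate (d - k) 0 \<and>
     covers (Suc d) ((1 # replicate d 0) # (2 # replicate d 0) # walk (replicate (Suc d) 0) ms)"

text \<open>Distinctness comes from counting: a list that covers the cube and is as long as the cube
  is large has no repetition.\<close>

lemma certificate_imp_spanned:
  assumes "certificate d k c ms"
  shows "spanned (cube_edges (Suc d))
      (cube_vertices (Suc d) - {1 # replicate d 0, 2 # replicate d 0})
      (replicate (Suc d) 0) (c # replicate k 1 @ replicate (d - k) 0)"
proof -
  let ?V = "cube_vertices (Suc d)" and ?w = "walk (replicate (Suc d) 0) ms"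
  let ?vs = "(1 # replicate d 0) # (2 # replicate d 0) # ?w"
  have "?V \<subseteq> set ?vs"
    using assms unfolding certificate_def by (intro covers_imp_subset) blast
  moreover have len: "length ?vs = card ?V"
    using assms by (simp add: certificate_def length_walk card_cube_vertices)
  ultimately have V: "?V = set ?vs"
    using card_length[of ?vs] by (intro card_seteq) auto
  have "distinct ?vs" using len unfolding V by (intro card_distinct) (rule sym)
  then show ?thesis
    unfolding spanned_def V using assms linked_walk[of "replicate (Suc d) 0" "Suc d" ms] hd_walk
    by (intro exI[of _ ?w]) (auto simp: certificate_def)
qed

text \<open>The move sequences below were found with a SAT solver.\<close>

lemma certificate_4_1_0: "certificate 3 1 0
    [(3,1), (0,2), (1,2), (3,2), (2,2), (3,1), (1,1), (3,1), (2,2), (1,1), (2,1), (0,1),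
     (2,2), (3,2), (2,1), (1,2), (3,2), (1,1), (0,2), (2,1), (0,2), (3,1), (2,2), (1,2),
     (3,1), (2,2), (1,2), (2,2), (3,1), (2,1), (1,1), (0,2), (3,1), (0,2), (1,2), (0,1),
     (3,1), (2,2), (3,1)]"
  by code_simp

lemma certificate_4_1_1: "certificate 3 1 1
    [(3,2), (0,2), (2,1), (0,1), (1,1), (0,2), (2,2), (0,2), (3,1), (0,1), (2,2), (1,2),
     (0,1), (3,2), (1,1), (3,2), (2,2), (0,2), (2,1), (1,2), (2,2), (0,2), (2,1), (1,1),
     (3,1), (1,1), (2,1), (3,1), (2,1), (1,1), (0,2), (1,2), (2,2), (3,1), (2,1), (0,2),
     (3,1), (2,2), (3,1)]"
  by code_simp

lemma certificate_4_2_0: "certificate 3 2 0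
    [(2,2), (0,2), (1,1), (0,1), (2,1), (0,2), (3,2), (0,2), (1,2), (0,2), (2,1), (1,1),
     (0,1), (1,2), (3,1), (1,2), (0,1), (1,1), (3,1), (1,1), (0,1), (2,1), (0,2), (1,2),
     (0,1), (2,1), (0,1), (1,2), (2,2), (3,1), (1,2), (0,1), (1,1), (2,1), (3,1), (0,1),
     (3,1), (2,2), (3,2)]"
  by code_simp

lemma certificate_4_2_1: "certificate 3 2 1
    [(2,1), (1,2), (2,2), (0,2), (3,2), (0,2), (1,2), (0,1), (3,1), (0,2), (2,1), (1,2),
     (3,2), (1,1), (0,2), (1,2), (2,1), (1,1), (3,2), (2,2), (0,1), (2,2), (1,2), (0,2),
     (2,2), (0,1), (3,1), (1,2), (3,2), (0,2), (2,2), (0,2), (3,2), (1,1), (3,2), (2,1),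
     (1,1), (3,1), (1,1)]"
  by code_simp

lemma certificate_4_3_0: "certificate 3 3 0
    [(3,1), (0,2), (2,1), (0,1), (1,1), (0,1), (3,1), (0,2), (1,2), (0,2), (2,2), (1,2),
     (2,2), (3,2), (2,1), (0,1), (3,2), (0,1), (2,1), (3,2), (2,2), (1,2), (3,2), (0,2),
     (3,2), (2,1), (1,2), (0,2), (1,1), (2,1), (3,2), (0,2), (3,2), (1,2), (3,2), (0,2),
     (3,1), (1,2), (3,1)]"
  by code_simp

lemma certificate_4_3_1: "certificate 3 3 1
    [(1,1), (0,1), (2,2), (1,1), (3,1), (1,2), (2,1), (1,1), (3,1), (1,1), (2,1), (1,2),
     (3,2), (0,2), (2,1), (3,1), (2,1), (1,1), (2,2), (3,2), (2,2), (0,2), (2,2), (1,2),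
     (3,1), (1,1), (2,1), (1,1), (3,1), (1,2), (0,1), (1,1), (3,1), (2,1), (3,1), (0,2),
     (3,1), (1,1), (3,2)]"
  by code_simp

lemma certificate_5_1_0: "certificate 4 1 0
    [(2,1), (0,1), (4,2), (0,2), (3,1), (0,2), (2,2), (4,2), (3,1), (4,1), (2,2), (4,1),
     (3,1), (4,1), (0,1), (2,1), (3,1), (4,1), (3,2), (0,1), (3,2), (2,2), (3,1), (1,1),
     (0,1), (4,2), (0,2), (3,2), (0,1), (4,1), (0,2), (2,2), (0,2), (3,1), (0,2), (4,1),
     (0,1), (2,2), (0,2), (3,1), (0,2), (4,2), (2,1), (4,2), (3,1), (0,2), (3,2), (2,1),
     (4,2), (0,1), (3,1), (2,2), (0,2), (2,2), (4,2), (3,1), (0,2), (3,1), (2,1), (4,2),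
     (2,2), (3,2), (0,2), (1,1), (2,1), (0,1), (2,1), (3,1), (0,2), (4,2), (0,2), (2,2),
     (1,1), (0,1), (2,1), (3,1), (2,2), (0,2), (2,1), (4,2), (3,2), (4,2), (0,1), (2,2),
     (0,1), (3,1), (0,2), (2,2), (1,2), (0,2), (2,1), (0,2), (4,1), (2,2), (0,2), (2,2),
     (4,1), (0,2), (2,1), (0,1), (3,2), (4,1), (0,1), (4,1), (2,1), (4,2), (0,2), (4,2),
     (3,2), (0,1), (2,1), (0,1), (4,2), (3,1), (2,2), (3,2), (0,2), (2,2), (0,1), (4,1)]"
  by code_simp

lemma certificate_5_1_1: "certificate 4 1 1
    [(4,2), (0,2), (3,1), (0,1), (2,1), (3,2), (4,1), (0,1), (4,2), (3,2), (2,1), (0,2),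
     (4,2), (2,1), (4,2), (0,1), (2,1), (0,1), (4,2), (3,2), (4,2), (0,1), (2,2), (0,2),
     (3,2), (2,2), (3,1), (4,2), (3,2), (0,1), (4,2), (0,1), (1,1), (2,1), (0,2), (2,1),
     (3,1), (2,2), (4,2), (3,1), (4,2), (2,2), (4,1), (3,2), (0,2), (3,2), (4,2), (3,1),
     (0,2), (3,1), (4,2), (2,2), (4,2), (0,1), (4,1), (2,2), (4,2), (3,2), (4,1), (2,1),
     (4,2), (0,2), (4,1), (2,2), (4,1), (3,2), (0,2), (2,1), (0,2), (4,1), (0,2), (2,2),
     (1,1), (0,2), (3,1), (2,2), (4,1), (0,2), (4,2), (2,2), (3,1), (2,1), (0,2), (3,1),
     (0,2), (4,2), (0,1), (3,2), (0,1), (2,2), (0,1), (4,2), (3,1), (4,1), (0,1), (4,1),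
     (3,1), (4,2), (0,2), (1,1), (2,2), (0,1), (2,2), (4,1), (3,1), (2,1), (1,2), (4,1),
     (2,2), (0,1), (2,2), (3,1), (2,2), (0,1), (3,1), (0,1), (4,1), (0,2), (3,2), (0,2)]"
  by code_simp

lemma certificate_5_2_0: "certificate 4 2 0
    [(3,1), (0,2), (2,1), (3,1), (2,1), (0,2), (3,1), (0,2), (4,1), (0,1), (3,1), (0,2),
     (4,1), (0,2), (3,1), (2,1), (3,2), (0,1), (3,1), (2,1), (4,2), (2,2), (3,2), (0,2),
     (3,1), (2,1), (3,1), (0,1), (4,1), (0,1), (2,1), (1,1), (0,1), (4,1), (2,1), (3,2),
     (0,1), (3,1), (2,2), (3,2), (0,1), (3,2), (2,2), (3,1), (0,2), (4,2), (2,1), (0,1),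
     (2,2), (3,1), (0,1), (3,1), (4,2), (0,2), (3,2), (0,2), (2,2), (3,1), (0,2), (3,1),
     (2,2), (0,2), (3,2), (0,1), (4,1), (0,1), (2,1), (0,2), (3,2), (0,2), (4,2), (1,1),
     (4,1), (0,1), (4,2), (3,1), (0,2), (4,2), (0,2), (3,1), (0,1), (2,1), (0,2), (4,1),
     (2,1), (4,1), (3,2), (2,2), (4,1), (1,1), (4,2), (0,1), (4,1), (3,1), (4,2), (2,2),
     (4,2), (1,2), (2,1), (3,2), (4,1), (3,1), (2,2), (0,1), (2,2), (3,2), (2,2), (4,2),
     (3,2), (4,2), (0,1), (4,1), (2,1), (0,2), (3,1), (0,2), (4,2), (0,1), (3,2), (0,1)]"
  by code_simp

lemma certificate_5_2_1: "certificate 4 2 1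
    [(4,2), (0,1), (3,1), (2,1), (3,1), (0,1), (3,2), (2,1), (4,1), (2,1), (0,1), (4,1),
     (0,2), (3,1), (4,2), (2,2), (4,2), (0,1), (3,1), (0,1), (1,1), (3,2), (0,2), (3,2),
     (4,2), (2,1), (0,2), (3,1), (4,1), (0,2), (3,2), (0,1), (2,2), (4,1), (2,1), (0,2),
     (3,2), (0,2), (4,1), (2,1), (4,1), (3,2), (0,1), (3,2), (4,1), (3,1), (0,2), (2,1),
     (0,1), (3,1), (0,1), (4,2), (2,2), (4,2), (3,2), (0,1), (2,1), (0,1), (3,1), (2,1),
     (1,1), (2,1), (4,1), (3,1), (4,2), (2,2), (4,2), (0,1), (4,2), (2,2), (0,1), (3,1),
     (0,2), (2,1), (0,1), (3,1), (0,2), (4,1), (0,1), (2,2), (3,1), (0,1), (3,1), (2,1),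
     (0,1), (2,1), (3,1), (4,1), (3,2), (0,1), (4,1), (3,2), (4,1), (1,1), (4,1), (0,2),
     (3,2), (0,1), (4,2), (0,1), (3,2), (2,1), (3,1), (0,2), (3,2), (2,1), (4,1), (2,2),
     (3,1), (0,1), (3,2), (2,1), (1,2), (0,2), (3,1), (2,2), (3,2), (0,2), (3,1), (4,2)]"
  by code_simp

lemma certificate_5_3_0: "certificate 4 3 0
    [(2,2), (0,1), (3,2), (0,1), (2,2), (0,2), (3,1), (4,2), (2,1), (1,1), (3,2), (0,1),
     (3,2), (2,2), (4,2), (2,1), (0,2), (3,2), (0,2), (4,2), (2,1), (3,2), (2,1), (0,2),
     (4,1), (2,2), (4,2), (3,1), (2,2), (3,1), (0,2), (3,2), (2,1), (3,1), (4,2), (3,2),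
     (0,2), (3,1), (2,1), (3,2), (0,1), (3,1), (4,2), (3,2), (0,2), (3,2), (2,2), (3,1),
     (0,1), (1,1), (2,1), (0,2), (2,2), (3,2), (2,1), (4,2), (0,1), (3,2), (4,2), (3,2),
     (0,2), (2,1), (3,1), (2,2), (4,1), (1,1), (2,2), (0,2), (2,2), (4,2), (0,2), (2,2),
     (0,2), (3,2), (2,2), (3,2), (4,2), (3,2), (0,1), (2,1), (0,2), (3,1), (0,2), (2,1),
     (0,1), (3,1), (0,2), (2,2), (4,1), (2,2), (3,2), (2,2), (0,2), (2,1), (4,2), (1,2),
     (2,2), (4,2), (3,2), (4,1), (0,1), (3,1), (2,1), (3,1), (4,2), (2,2), (3,1), (2,2),
     (4,2), (2,1), (3,1), (2,1), (0,2), (3,2), (4,1), (3,1), (0,2), (3,1), (2,2), (3,2)]"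
  by code_simp

lemma certificate_5_3_1: "certificate 4 3 1
    [(2,2), (0,2), (3,1), (4,2), (0,1), (2,1), (0,2), (3,2), (0,1), (2,2), (0,1), (1,1),
     (0,2), (2,2), (4,2), (2,2), (3,1), (0,2), (2,1), (0,2), (3,2), (4,1), (3,2), (2,1),
     (0,2), (2,2), (4,1), (0,1), (2,2), (0,1), (4,1), (2,2), (0,2), (3,2), (4,2), (2,1),
     (0,1), (2,2), (3,2), (0,1), (3,1), (4,2), (2,1), (0,2), (2,1), (3,2), (4,2), (2,2),
     (4,2), (0,2), (4,1), (1,1), (0,1), (4,1), (0,1), (2,1), (3,2), (2,2), (4,1), (3,2),
     (4,1), (0,2), (2,2), (0,1), (3,2), (0,2), (4,2), (0,2), (2,2), (4,1), (0,2), (3,2),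
     (0,2), (2,2), (4,1), (2,1), (3,2), (2,1), (0,2), (2,2), (4,1), (2,1), (0,1), (2,2),
     (3,1), (0,1), (3,2), (1,1), (2,2), (0,1), (2,1), (3,2), (4,2), (3,2), (0,2), (4,2),
     (0,2), (2,2), (3,1), (2,1), (4,2), (3,1), (4,1), (0,2), (2,1), (3,1), (4,1), (0,2),
     (4,2), (3,1), (2,1), (3,2), (4,2), (0,1), (4,1), (1,2), (4,1), (2,2), (4,1), (0,1)]"
  by code_simp

lemma certificate_5_4_0: "certificate 4 4 0
    [(2,2), (4,1), (2,1), (3,1), (2,2), (4,2), (0,2), (4,2), (3,2), (4,2), (2,2), (3,2),
     (2,1), (0,2), (3,1), (4,1), (1,1), (3,2), (4,2), (3,2), (2,2), (0,1), (2,1), (4,2),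
     (2,1), (3,1), (2,2), (4,1), (2,2), (0,1), (2,1), (3,1), (2,2), (4,1), (2,1), (3,2),
     (2,1), (0,2), (3,2), (0,1), (4,1), (3,1), (2,2), (3,1), (0,2), (4,1), (2,2), (4,1),
     (3,1), (0,2), (3,2), (4,1), (3,1), (2,2), (3,2), (4,1), (1,1), (4,2), (2,1), (0,1),
     (2,2), (3,1), (0,1), (3,1), (2,2), (3,2), (4,2), (2,1), (3,2), (2,1), (0,2), (2,2),
     (3,1), (2,2), (4,2), (2,1), (0,1), (3,1), (2,1), (3,1), (0,2), (2,1), (0,2), (3,1),
     (4,1), (2,2), (4,1), (0,2), (1,1), (0,2), (3,1), (2,1), (0,1), (2,2), (4,2), (2,2),
     (3,1), (0,2), (3,1), (4,1), (0,2), (4,2), (2,1), (0,1), (3,2), (0,2), (4,2), (3,2),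
     (4,1), (2,2), (4,2), (1,2), (4,2), (2,1), (4,2), (0,1), (4,2), (2,1), (4,1), (0,1)]"
  by code_simp

lemma certificate_5_4_1: "certificate 4 4 1
    [(4,1), (2,2), (0,2), (2,1), (3,2), (4,1), (3,1), (2,2), (0,2), (1,1), (3,2), (4,1),
     (3,1), (2,1), (3,1), (0,1), (4,1), (0,1), (3,1), (2,2), (4,2), (2,2), (0,1), (4,2),
     (3,2), (4,2), (0,1), (4,1), (3,2), (4,1), (2,2), (4,2), (0,2), (3,2), (0,1), (4,2),
     (2,2), (4,1), (3,2), (4,2), (0,1), (4,1), (2,2), (3,2), (4,1), (2,1), (4,1), (0,1),
     (2,1), (1,1), (4,1), (0,2), (2,1), (0,2), (4,2), (2,1), (0,1), (2,1), (3,1), (2,2),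
     (4,1), (2,2), (0,1), (2,2), (4,2), (2,1), (3,1), (4,2), (3,2), (0,2), (1,1), (3,1),
     (2,1), (3,1), (0,2), (3,1), (4,1), (0,2), (2,2), (0,1), (4,2), (3,1), (4,1), (0,1),
     (2,1), (0,1), (4,1), (0,2), (2,2), (3,2), (2,2), (4,1), (0,1), (2,1), (3,2), (4,2),
     (3,1), (2,2), (3,1), (4,2), (1,2), (4,1), (0,2), (2,1), (4,1), (2,2), (3,1), (2,2),
     (0,1), (3,2), (4,1), (0,1), (2,2), (4,2), (2,2), (3,2), (4,1), (2,2), (4,1), (3,1)]"
  by code_simp

section \<open>Raising the dimension by two\<close>

text \<open>The line through \<open>q\<close> is taken in a direction other than some coordinate
  where \<open>p\<close> and \<open>q\<close> differ, so \<open>p\<close> lies off it. The path from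
  the tip \<open>?r\<close> to \<open>p\<close> is then extended by the edge from \<open>q\<close>
  through \<open>?m\<close>.\<close>

lemma tip_connected_imp_spanned:
  assumes "tip_connected d" "2 \<le> d" "p \<in> cube_vertices d" "q \<in> cube_vertices d" "p \<noteq> q"
  shows "spanned (cube_edges d) (cube_vertices d) p q"
proof -
  obtain c where c: "c < d" "p ! c \<noteq> q ! c"
    using assms(3-5) by (metis length_cube_vertex nth_equalityI)
  obtain i where i: "i < d" "i \<noteq> c" using assms(2) that[of 0] that[of 1] by (cases "c = 0") auto
  obtain x y where xy: "{q ! i, x, y} = {..<3}"
  proof -
    consider "q ! i = 0" | "q ! i = 1" | "q ! i = 2"
      using nth_cube_vertex[OF assms(4) i(1)] by linarith
    then show ?thesis
    proof cases
      case 1 show ?thesis by (rule that[of 1 2]) (use 1 in auto)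
    next
      case 2 show ?thesis by (rule that[of 0 2]) (use 2 in auto)
    next
      case 3 show ?thesis by (rule that[of 0 1]) (use 3 in auto)
    qed
  qed
  let ?m = "q[i := x]" and ?r = "q[i := y]"
  have e: "{q, ?m, ?r} \<in> cube_edges d"
    using cube_edge_triple[OF assms(4) i(1) xy] by simp
  note ne = cube_edge_distinct[OF e] and sub = cube_edge_subset[OF e]
  have "p \<notin> {?r, ?m, q}" using c i by (auto simp: nth_list_update)
  then have "spanned (cube_edges d) (cube_vertices d - {?m, q}) ?r p"
    using assms(1,3) e unfolding tip_connected_def by (auto simp: insert_commute)
  then have "spanned (cube_edges d) (insert ?m ({q} \<union> (cube_vertices d - {?m, q}))) q p"
    using ne by (intro spanned_join[OF spanned_singleton _ e]) auto
  moreover have "insert ?m ({q} \<union> (cube_vertices d - {?m, q})) = cube_vertices d"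
    using sub by auto
  ultimately show ?thesis using spanned_sym by metis
qed

text \<open>The entry \<open>v\<close> belongs to the direction of the given line and comes first in
  the list; \<open>u\<close> is the entry in the second splitting coordinate.\<close>

definition block :: "nat \<Rightarrow> nat \<Rightarrow> nat list set \<Rightarrow> nat list set" where
  "block u v S = (\<lambda>x. v # u # x) ` S"

lemma Cons_Cons_in_block [simp]: "v' # u' # x \<in> block u v S \<longleftrightarrow> v' = v \<and> u' = u \<and> x \<in> S"
  by (auto simp: block_def)

lemma block_disjoint [simp]: "u \<noteq> u' \<or> v \<noteq> v' \<Longrightarrow> block u v S \<inter> block u' v' T = {}"
  by (auto simp: block_def)

lemma block_subset [simp]:
  "u < 3 \<Longrightarrow> v < 3 \<Longrightarrow> S \<subseteq> cube_vertices d \<Longrightarrow> block u v S \<subseteq> cube_vertices (Suc (Suc d))"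
  by (auto simp: block_def)

text \<open>With \<open>u\<close> and \<open>v\<close> ranging over explicit sets, an equality of
  vertex sets splits into nine cases that simplification can decide.\<close>

lemma blockwise_eqI:
  assumes "A \<subseteq> cube_vertices (Suc (Suc d))" "B \<subseteq> cube_vertices (Suc (Suc d))"
    and "\<And>u v x. u \<in> {0, 1, 2} \<Longrightarrow> v \<in> {0, 1, 2} \<Longrightarrow> x \<in> cube_vertices d \<Longrightarrow>
      v # u # x \<in> A \<longleftrightarrow> v # u # x \<in> B"
  shows "A = B"
proof -
  have three: "{..<3} = {0, 1, 2 :: nat}" by auto
  have "w \<in> A \<longleftrightarrow> w \<in> B" if w: "w \<in> cube_vertices (Suc (Suc d))" for w
  proof -
    obtain u v x where "w = v # u # x" "u < 3" "v < 3" "x \<in> cube_vertices d"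
      using w by (auto simp: cube_vertices_Suc)
    then show ?thesis using assms(3)[of u v x] three by blast
  qed
  then show ?thesis using assms(1,2) by blast
qed

text \<open>The tours below visit the nine blocks one after the other, moving between blocks only at
  points of the plane \<open>P\<close>. Each block is spanned by one long path, up to at most two vertices
  that are used otherwise: as the middle vertex of a move, as a vertex where two moves in
  different directions meet, or as one of the two vertices omitted by the whole tour. The tours
  were found by a computer search for arrangements in which the two exceptional vertices of a
  block are collinear with an end of its long path. The plane contains the projection of the
  target; apart from that point it avoids the projection \<open>a\<close> of the start.\<close>

locale block_tour =
  fixes d :: nat and P :: "nat \<Rightarrow> nat \<Rightarrow> nat list" and a :: "nat list"
  assumes tip: "tip_connected d" "3 \<le> d"
    and a [simp]: "a \<in> cube_vertices d"
    and P [simp]: "\<And>s t. s < 3 \<Longrightarrow> t < 3 \<Longrightarrow> P s t \<in> cube_vertices d"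
    and P_inj [simp]: "\<And>s t s' t'. P s t = P s' t' \<longleftrightarrow> s = s' \<and> t = t'"
    and P_avoids: "\<And>s t. P s t = a \<Longrightarrow> s = 0 \<and> t = 0"
    and P_edge:
      "\<And>s x y z. s < 3 \<Longrightarrow> {x, y, z} = {..<3} \<Longrightarrow> {P s x, P s y, P s z} \<in> cube_edges d"
      "\<And>t x y z. t < 3 \<Longrightarrow> {x, y, z} = {..<3} \<Longrightarrow> {P x t, P y t, P z t} \<in> cube_edges d"

text \<open>The plane varies two coordinates other than one where \<open>a\<close> is nonzero, so
  its points are 0 there and differ from \<open>a\<close>. If \<open>a\<close> is the zero vector,
  it is \<open>P 0 0\<close> and no other point of the plane.\<close>

lemma exists_block_tour:
  assumes "tip_connected d" "3 \<le> d" "a \<in> cube_vertices d"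
  obtains P where "P 0 0 = replicate d 0" "block_tour d P a"
proof -
  obtain c where c: "a \<noteq> replicate d 0 \<Longrightarrow> c < d \<and> a ! c \<noteq> 0"
    using assms(3) by (metis length_cube_vertex length_replicate nth_equalityI nth_replicate)
  obtain i j where ij: "i < d" "j < d" "i \<noteq> j" "i \<noteq> c" "j \<noteq> c"
  proof -
    consider "c = 0" | "c = 1" | "2 \<le> c" by linarith
    then show ?thesis
    proof cases
      case 1 show ?thesis by (rule that[of 1 2]) (use 1 assms(2) in auto)
    next
      case 2 show ?thesis by (rule that[of 0 2]) (use 2 assms(2) in auto)
    next
      case 3 show ?thesis by (rule that[of 0 1]) (use 3 assms(2) in auto)
    qed
  qed
  define P where "P s t = (replicate d (0 :: nat))[i := s, j := t]" for s t
  have nth: "P s t ! i = s" "P s t ! j = t" "c < d \<Longrightarrow> P s t ! c = 0" for s t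
    using ij by (auto simp: P_def)
  have P: "P s t \<in> cube_vertices d" if "s < 3" "t < 3" for s t
    using that by (simp add: P_def list_update_in_cube_vertices)
  have P0: "P 0 0 = replicate d 0"
    unfolding P_def using ij by (metis list_update_id nth_replicate)
  have inj: "P s t = P s' t' \<longleftrightarrow> s = s' \<and> t = t'" for s t s' t' using nth by metis
  have "block_tour d P a"
  proof
    show "s = 0 \<and> t = 0" if "P s t = a" for s t
      using that c nth(3) P0 inj by metis
    show "{P s x, P s y, P s z} \<in> cube_edges d" if "s < 3" "{x, y, z} = {..<3}" for s x y z
      using cube_edge_triple[OF P[of s 0] ij(2) that(2)] that(1) by (simp add: P_def)
    show "{P x t, P y t, P z t} \<in> cube_edges d" if "t < 3" "{x, y, z} = {..<3}" for t x y z
      using cube_edge_triple[OF P[of 0 t] ij(1) that(2)] that(1) ij(3)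
      by (simp add: P_def list_update_swap)
  qed (use assms P inj in auto)
  with P0 show ?thesis by (rule that)
qed

context block_tour
begin

lemma P_eq_a [simp]: "s \<noteq> 0 \<or> t \<noteq> 0 \<Longrightarrow> P s t \<noteq> a" "s \<noteq> 0 \<or> t \<noteq> 0 \<Longrightarrow> a \<noteq> P s t"
  using P_avoids by auto

lemma spanned_Cons_Cons:
  assumes "spanned (cube_edges d) S p q" "u < 3" "v < 3"
  shows "spanned (cube_edges (Suc (Suc d))) (block u v S) (v # u # p) (v # u # q)"
  unfolding block_def
proof (rule spanned_image[OF assms(1)])
  fix e assume "e \<in> cube_edges d"
  then have "(#) v ` (#) u ` e \<in> cube_edges (Suc (Suc d))"
    using assms by (intro Cons_image_cube_edge)
  then show "(\<lambda>x. v # u # x) ` e \<in> cube_edges (Suc (Suc d))" by (simp add: image_image)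
qed (simp add: inj_on_def)

lemma spanned_block:
  assumes "p \<in> cube_vertices d" "q \<in> cube_vertices d" "p \<noteq> q" "u < 3" "v < 3"
  shows "spanned (cube_edges (Suc (Suc d)))
    (block u v (cube_vertices d)) (v # u # p) (v # u # q)"
  using assms tip by (intro spanned_Cons_Cons tip_connected_imp_spanned) auto

lemma spanned_block_tip:
  assumes "{r, m, n} \<in> cube_edges d" "q \<in> cube_vertices d" "q \<noteq> r" "q \<noteq> m" "q \<noteq> n"
    and "u < 3" "v < 3"
  shows "spanned (cube_edges (Suc (Suc d)))
    (block u v (cube_vertices d - {m, n})) (v # u # r) (v # u # q)"
  using assms tip(1) unfolding tip_connected_def by (intro spanned_Cons_Cons) auto

text \<open>A move that changes \<open>v\<close> and keeps \<open>u\<close>; its middle vertex lies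
  in the third block of that row. \<open>inner_edge\<close> does the same with the roles
  exchanged.\<close>

lemma outer_edge:
  assumes "x \<in> cube_vertices d" "u < 3" "{v, v', v''} = {..<3}"
  shows "{v # u # x, v' # u # x, v'' # u # x} \<in> cube_edges (Suc (Suc d))"
  using assms by (intro Cons_cube_edge) auto

lemma inner_edge:
  assumes "x \<in> cube_vertices d" "v < 3" "{u, u', u''} = {..<3}"
  shows "{v # u # x, v # u' # x, v # u'' # x} \<in> cube_edges (Suc (Suc d))"
  using Cons_image_cube_edge[OF Cons_cube_edge[OF assms(1,3)] assms(2)] by simp

text \<open>The case \<open>c = 0\<close> of the normal form. The tour is built from the target: the
  \<open>?S\<close> sets are its pieces in order, the \<open>?R\<close> sets what has been visited
  so far. Each inserted vertex is the middle of a move and is spared by the piece of its own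
  block.\<close>

lemma block_walk_same:
  "spanned (cube_edges (Suc (Suc d)))
    (cube_vertices (Suc (Suc d)) - {1 # 0 # P 0 0, 2 # 0 # P 0 0})
    (0 # 0 # P 0 0) (0 # 1 # a)"
proof -
  let ?V = "cube_vertices d" and ?E = "cube_edges (Suc (Suc d))"
  let ?S0 = "block 1 0 (?V - {P 1 1, P 2 1})"
  have s0: "spanned ?E ?S0 (0 # 1 # a) (0 # 1 # P 0 1)"
    by (rule spanned_block_tip[OF P_edge(2), THEN spanned_sym]) auto
  let ?S1 = "block 1 1 (?V - {P 1 1, P 2 1})"
  have s1: "spanned ?E ?S1 (1 # 1 # P 0 1) (1 # 1 # P 0 2)"
    by (rule spanned_block_tip[OF P_edge(2)]) auto
  let ?S2 = "block 2 1 ?V"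
  have s2: "spanned ?E ?S2 (1 # 2 # P 0 2) (1 # 2 # P 1 1)"
    by (rule spanned_block) auto
  \<comment> \<open>\<open>P 0 0\<close> is spared here and in \<open>?S4\<close> because the whole
    tour omits it in these two blocks; \<open>P 0 2\<close> serves as a middle vertex in
    both.\<close>
  let ?S3 = "block 0 1 (?V - {P 0 0, P 0 2})"
  have s3: "spanned ?E ?S3 (1 # 0 # P 1 1) (1 # 0 # P 0 1)"
    by (rule spanned_block_tip[OF P_edge(1), THEN spanned_sym]) auto
  let ?S4 = "block 0 2 (?V - {P 0 0, P 0 2})"
  have s4: "spanned ?E ?S4 (2 # 0 # P 0 1) (2 # 0 # P 1 1)"
    by (rule spanned_block_tip[OF P_edge(1)]) auto
  let ?S5 = "block 2 2 ?V"
  have s5: "spanned ?E ?S5 (2 # 2 # P 1 1) (2 # 2 # P 0 2)"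
    by (rule spanned_block) auto
  let ?S6 = "block 1 2 (?V - {P 0 1, P 1 1})"
  have s6: "spanned ?E ?S6 (2 # 1 # P 0 2) (2 # 1 # P 2 1)"
    by (rule spanned_block_tip[OF P_edge(2), THEN spanned_sym]) auto
  \<comment> \<open>A vertex spared by \<open>?S0\<close>: the tour arrives here by changing
    \<open>v\<close> and leaves by changing \<open>u\<close>.\<close>
  let ?S7 = "{0 # 1 # P 2 1}"
  have s7: "spanned ?E ?S7 (0 # 1 # P 2 1) (0 # 1 # P 2 1)"
    by (rule spanned_singleton)
  let ?S8 = "block 2 0 ?V"
  have s8: "spanned ?E ?S8 (0 # 2 # P 2 1) (0 # 2 # P 1 1)"
    by (rule spanned_block) auto
  let ?S9 = "block 0 0 (?V - {P 0 1, P 2 1})"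
  have s9: "spanned ?E ?S9 (0 # 0 # P 1 1) (0 # 0 # P 0 0)"
    by (rule spanned_block_tip[OF P_edge(2)]) auto
  let ?R0 = "?S0"
  note r0 = s0
  let ?R1 = "insert (2 # 1 # P 0 1) (?R0 \<union> ?S1)"
  have r1: "spanned ?E ?R1 (0 # 1 # a) (1 # 1 # P 0 2)"
    by (rule spanned_join[OF r0 s1 outer_edge]) (auto simp: Int_Un_distrib2)
  let ?R2 = "insert (1 # 0 # P 0 2) (?R1 \<union> ?S2)"
  have r2: "spanned ?E ?R2 (0 # 1 # a) (1 # 2 # P 1 1)"
    by (rule spanned_join[OF r1 s2 inner_edge]) (auto simp: Int_Un_distrib2)
  let ?R3 = "insert (1 # 1 # P 1 1) (?R2 \<union> ?S3)"
  have r3: "spanned ?E ?R3 (0 # 1 # a) (1 # 0 # P 0 1)"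
    by (rule spanned_join[OF r2 s3 inner_edge]) (auto simp: Int_Un_distrib2)
  let ?R4 = "insert (0 # 0 # P 0 1) (?R3 \<union> ?S4)"
  have r4: "spanned ?E ?R4 (0 # 1 # a) (2 # 0 # P 1 1)"
    by (rule spanned_join[OF r3 s4 outer_edge]) (auto simp: Int_Un_distrib2)
  let ?R5 = "insert (2 # 1 # P 1 1) (?R4 \<union> ?S5)"
  have r5: "spanned ?E ?R5 (0 # 1 # a) (2 # 2 # P 0 2)"
    by (rule spanned_join[OF r4 s5 inner_edge]) (auto simp: Int_Un_distrib2)
  let ?R6 = "insert (2 # 0 # P 0 2) (?R5 \<union> ?S6)"
  have r6: "spanned ?E ?R6 (0 # 1 # a) (2 # 1 # P 2 1)"
    by (rule spanned_join[OF r5 s6 inner_edge]) (auto simp: Int_Un_distrib2)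
  let ?R7 = "insert (1 # 1 # P 2 1) (?R6 \<union> ?S7)"
  have r7: "spanned ?E ?R7 (0 # 1 # a) (0 # 1 # P 2 1)"
    by (rule spanned_join[OF r6 s7 outer_edge]) (auto simp: Int_Un_distrib2)
  let ?R8 = "insert (0 # 0 # P 2 1) (?R7 \<union> ?S8)"
  have r8: "spanned ?E ?R8 (0 # 1 # a) (0 # 2 # P 1 1)"
    by (rule spanned_join[OF r7 s8 inner_edge]) (auto simp: Int_Un_distrib2)
  let ?R9 = "insert (0 # 1 # P 1 1) (?R8 \<union> ?S9)"
  have r9: "spanned ?E ?R9 (0 # 1 # a) (0 # 0 # P 0 0)"
    by (rule spanned_join[OF r8 s9 inner_edge]) (auto simp: Int_Un_distrib2)
  have "?R9 = cube_vertices (Suc (Suc d)) - {1 # 0 # P 0 0, 2 # 0 # P 0 0}"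
  proof (rule blockwise_eqI)
    fix u v :: nat and x
    assume "u \<in> {0, 1, 2}" "v \<in> {0, 1, 2}" "x \<in> ?V"
    then show "v # u # x \<in> ?R9 \<longleftrightarrow>
        v # u # x \<in> cube_vertices (Suc (Suc d)) - {1 # 0 # P 0 0, 2 # 0 # P 0 0}"
      by (elim insertE emptyE) auto
  qed simp_all
  with spanned_sym[OF r9] show ?thesis by simp
qed

text \<open>The case \<open>c = 1\<close>: the target now lies in the block with
  \<open>v = 1\<close> and \<open>u = 1\<close>, which calls for another order of the blocks. The
  vertex where two moves in different directions meet is \<open>?S2\<close>.\<close>

lemma block_walk_diff:
  "spanned (cube_edges (Suc (Suc d)))
    (cube_vertices (Suc (Suc d)) - {1 # 0 # P 0 0, 2 # 0 # P 0 0})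
    (0 # 0 # P 0 0) (1 # 1 # a)"
proof -
  let ?V = "cube_vertices d" and ?E = "cube_edges (Suc (Suc d))"
  let ?S0 = "block 1 1 (?V - {P 1 0, P 1 2})"
  have s0: "spanned ?E ?S0 (1 # 1 # a) (1 # 1 # P 1 1)"
    by (rule spanned_block_tip[OF P_edge(1), THEN spanned_sym]) auto
  let ?S1 = "block 1 0 ?V"
  have s1: "spanned ?E ?S1 (0 # 1 # P 1 1) (0 # 1 # P 1 2)"
    by (rule spanned_block) auto
  let ?S2 = "{1 # 1 # P 1 2}"
  have s2: "spanned ?E ?S2 (1 # 1 # P 1 2) (1 # 1 # P 1 2)"
    by (rule spanned_singleton)
  let ?S3 = "block 0 1 (?V - {P 0 0, P 2 0})"
  have s3: "spanned ?E ?S3 (1 # 0 # P 1 2) (1 # 0 # P 1 0)"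
    by (rule spanned_block_tip[OF P_edge(2), THEN spanned_sym]) auto
  let ?S4 = "block 2 1 (?V - {P 1 2, P 1 1})"
  have s4: "spanned ?E ?S4 (1 # 2 # P 1 0) (1 # 2 # P 0 1)"
    by (rule spanned_block_tip[OF P_edge(1)]) auto
  let ?S5 = "block 2 0 ?V"
  have s5: "spanned ?E ?S5 (0 # 2 # P 0 1) (0 # 2 # P 1 1)"
    by (rule spanned_block) auto
  let ?S6 = "block 2 2 (?V - {P 0 1, P 2 1})"
  have s6: "spanned ?E ?S6 (2 # 2 # P 1 1) (2 # 2 # P 1 0)"
    by (rule spanned_block_tip[OF P_edge(2)]) auto
  let ?S7 = "block 1 2 (?V - {P 1 1, P 1 2})"
  have s7: "spanned ?E ?S7 (2 # 1 # P 1 0) (2 # 1 # P 2 1)"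
    by (rule spanned_block_tip[OF P_edge(1)]) auto
  let ?S8 = "block 0 2 (?V - {P 0 0, P 1 0})"
  have s8: "spanned ?E ?S8 (2 # 0 # P 2 1) (2 # 0 # P 2 0)"
    by (rule spanned_block_tip[OF P_edge(2), THEN spanned_sym]) auto
  let ?S9 = "block 0 0 ?V"
  have s9: "spanned ?E ?S9 (0 # 0 # P 2 0) (0 # 0 # P 0 0)"
    by (rule spanned_block) auto
  let ?R0 = "?S0"
  note r0 = s0
  let ?R1 = "insert (2 # 1 # P 1 1) (?R0 \<union> ?S1)"
  have r1: "spanned ?E ?R1 (1 # 1 # a) (0 # 1 # P 1 2)"
    by (rule spanned_join[OF r0 s1 outer_edge]) (auto simp: Int_Un_distrib2)
  let ?R2 = "insert (2 # 1 # P 1 2) (?R1 \<union> ?S2)"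
  have r2: "spanned ?E ?R2 (1 # 1 # a) (1 # 1 # P 1 2)"
    by (rule spanned_join[OF r1 s2 outer_edge]) (auto simp: Int_Un_distrib2)
  let ?R3 = "insert (1 # 2 # P 1 2) (?R2 \<union> ?S3)"
  have r3: "spanned ?E ?R3 (1 # 1 # a) (1 # 0 # P 1 0)"
    by (rule spanned_join[OF r2 s3 inner_edge]) (auto simp: Int_Un_distrib2)
  let ?R4 = "insert (1 # 1 # P 1 0) (?R3 \<union> ?S4)"
  have r4: "spanned ?E ?R4 (1 # 1 # a) (1 # 2 # P 0 1)"
    by (rule spanned_join[OF r3 s4 inner_edge]) (auto simp: Int_Un_distrib2)
  let ?R5 = "insert (2 # 2 # P 0 1) (?R4 \<union> ?S5)"
  have r5: "spanned ?E ?R5 (1 # 1 # a) (0 # 2 # P 1 1)"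
    by (rule spanned_join[OF r4 s5 outer_edge]) (auto simp: Int_Un_distrib2)
  let ?R6 = "insert (1 # 2 # P 1 1) (?R5 \<union> ?S6)"
  have r6: "spanned ?E ?R6 (1 # 1 # a) (2 # 2 # P 1 0)"
    by (rule spanned_join[OF r5 s6 outer_edge]) (auto simp: Int_Un_distrib2)
  let ?R7 = "insert (2 # 0 # P 1 0) (?R6 \<union> ?S7)"
  have r7: "spanned ?E ?R7 (1 # 1 # a) (2 # 1 # P 2 1)"
    by (rule spanned_join[OF r6 s7 inner_edge]) (auto simp: Int_Un_distrib2)
  let ?R8 = "insert (2 # 2 # P 2 1) (?R7 \<union> ?S8)"
  have r8: "spanned ?E ?R8 (1 # 1 # a) (2 # 0 # P 2 0)"
    by (rule spanned_join[OF r7 s8 inner_edge]) (auto simp: Int_Un_distrib2)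
  let ?R9 = "insert (1 # 0 # P 2 0) (?R8 \<union> ?S9)"
  have r9: "spanned ?E ?R9 (1 # 1 # a) (0 # 0 # P 0 0)"
    by (rule spanned_join[OF r8 s9 outer_edge]) (auto simp: Int_Un_distrib2)
  have "?R9 = cube_vertices (Suc (Suc d)) - {1 # 0 # P 0 0, 2 # 0 # P 0 0}"
  proof (rule blockwise_eqI)
    fix u v :: nat and x
    assume "u \<in> {0, 1, 2}" "v \<in> {0, 1, 2}" "x \<in> ?V"
    then show "v # u # x \<in> ?R9 \<longleftrightarrow>
        v # u # x \<in> cube_vertices (Suc (Suc d)) - {1 # 0 # P 0 0, 2 # 0 # P 0 0}"
      by (elim insertE emptyE) auto
  qed simp_all
  with spanned_sym[OF r9] show ?thesis by simp
qed

end

lemma tip_connected_Suc_Suc: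
  assumes "tip_connected d" "3 \<le> d"
  shows "tip_connected (Suc (Suc d))"
proof (rule tip_connected_SucI)
  fix k c :: nat assume k: "0 < k" "k \<le> Suc d" and "c < 2"
  \<comment> \<open>As \<open>k\<close> is positive, the second entry of the target is 1;
    \<open>a\<close> is what remains after the first two entries.\<close>
  define a where "a = replicate (k - 1) (1 :: nat) @ replicate (Suc d - k) 0"
  have a: "a \<in> cube_vertices d" using k by (auto simp: a_def cube_vertices_eq_lists)
  obtain P where P0: "P 0 0 = replicate d 0" and "block_tour d P a"
    using exists_block_tour[OF assms a] .
  then interpret block_tour d P a by simp
  have "c = 0 \<or> c = 1" using \<open>c < 2\<close> by auto
  then have "spanned (cube_edges (Suc (Suc d)))
      (cube_vertices (Suc (Suc d)) - {1 # 0 # P 0 0, 2 # 0 # P 0 0})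
      (0 # 0 # P 0 0) (c # 1 # a)"
  proof
    assume "c = 0"
    then show ?thesis using block_walk_same by simp
  next
    assume "c = 1"
    then show ?thesis using block_walk_diff by simp
  qed
  moreover have "c # replicate k 1 @ replicate (Suc d - k) 0 = c # 1 # a"
    using k(1) by (cases k) (auto simp: a_def)
  ultimately show "spanned (cube_edges (Suc (Suc d)))
      (cube_vertices (Suc (Suc d)) - {1 # replicate (Suc d) 0, 2 # replicate (Suc d) 0})
      (replicate (Suc (Suc d)) 0) (c # replicate k 1 @ replicate (Suc d - k) 0)"
    by (simp add: P0)
qed

section \<open>Base cases and conclusion of the induction\<close>

lemma tip_connected_4: "tip_connected 4"
proof -
  have "tip_connected (Suc 3)"
  proof (rule tip_connected_SucI)
    fix k c :: nat assume "0 < k" "k \<le> 3" "c < 2"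
    then have "k \<in> {1, 2, 3}" "c \<in> {0, 1}" by auto
    then have "\<exists>ms. certificate 3 k c ms"
      using exI[of "certificate 3 1 0", OF certificate_4_1_0]
        exI[of "certificate 3 1 1", OF certificate_4_1_1]
        exI[of "certificate 3 2 0", OF certificate_4_2_0]
        exI[of "certificate 3 2 1", OF certificate_4_2_1]
        exI[of "certificate 3 3 0", OF certificate_4_3_0]
        exI[of "certificate 3 3 1", OF certificate_4_3_1]
      by blast
    then obtain ms where "certificate 3 k c ms" ..
    then show "spanned (cube_edges (Suc 3))
        (cube_vertices (Suc 3) - {1 # replicate 3 0, 2 # replicate 3 0})
        (replicate (Suc 3) 0) (c # replicate k 1 @ replicate (3 - k) 0)"
      by (rule certificate_imp_spanned)
  qed
  then show ?thesis by simp
qed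

lemma tip_connected_5: "tip_connected 5"
proof -
  have "tip_connected (Suc 4)"
  proof (rule tip_connected_SucI)
    fix k c :: nat assume "0 < k" "k \<le> 4" "c < 2"
    then have "k \<in> {1, 2, 3, 4}" "c \<in> {0, 1}" by auto
    then have "\<exists>ms. certificate 4 k c ms"
      using exI[of "certificate 4 1 0", OF certificate_5_1_0]
        exI[of "certificate 4 1 1", OF certificate_5_1_1]
        exI[of "certificate 4 2 0", OF certificate_5_2_0]
        exI[of "certificate 4 2 1", OF certificate_5_2_1]
        exI[of "certificate 4 3 0", OF certificate_5_3_0]
        exI[of "certificate 4 3 1", OF certificate_5_3_1]
        exI[of "certificate 4 4 0", OF certificate_5_4_0]
        exI[of "certificate 4 4 1", OF certificate_5_4_1]
      by blast
    then obtain ms where "certificate 4 k c ms" ..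
    then show "spanned (cube_edges (Suc 4))
        (cube_vertices (Suc 4) - {1 # replicate 4 0, 2 # replicate 4 0})
        (replicate (Suc 4) 0) (c # replicate k 1 @ replicate (4 - k) 0)"
      by (rule certificate_imp_spanned)
  qed
  then show ?thesis by simp
qed

text \<open>The step raises the dimension by two, so even dimensions start from 4 and odd ones from
  5.\<close>

lemma tip_connected_ge_4: "4 \<le> d \<Longrightarrow> tip_connected d"
proof (induction d rule: less_induct)
  case (less d)
  consider "d = 4" | "d = 5" | "6 \<le> d" using less.prems by linarith
  then show ?case
  proof cases
    case 3
    then have "tip_connected (Suc (Suc (d - 2)))"
      by (intro tip_connected_Suc_Suc less.IH) auto
    moreover have "Suc (Suc (d - 2)) = d" using 3 by linarith
    ultimately show ?thesis by simp
  qed (auto simp: tip_connected_4 tip_connected_5)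
qed

theorem theorem1p1:
  fixes d :: nat
  assumes "d \<ge> 4"
  shows "loose_hamilton_connected (cube_vertices d) (cube_edges d)"
  unfolding loose_hamilton_connected_def
proof (intro ballI impI)
  fix a b assume "a \<in> cube_vertices d" "b \<in> cube_vertices d" "a \<noteq> b"
  then have "spanned (cube_edges d) (cube_vertices d) a b"
    using assms by (intro tip_connected_imp_spanned tip_connected_ge_4) auto
  then show "\<exists>vs. loose_path (cube_edges d) vs \<and> hd vs = a \<and> last vs = b \<and> set vs = cube_vertices d"
    unfolding spanned_def using linked_imp_loose_path by blast
qed

end
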